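(* Let $(\mathcal{A},\circ,\alpha)$ be a Hom-pre-Jordan superalgebra. Then the product $$x\cdot y=x\circ y+(-1)^{|x||y|}y\circ x,\qquad x,y\in\mathcal{A}\ \text{homogeneous},$$ defines a Hom-Jordan superalgebra $(\mathcal{A},\cdot,\alpha)$ on $\mathcal{A}$.
   Context: $\mathbb{K}$ is an algebraically closed field of characteristic $0$; all spaces and linear maps are over $\mathbb{K}$. $|x|\in\mathbb{Z}_2$ is the parity of a homogeneous element $x$; identities involving parities are required for all homogeneous elements. A Hom-Jordan superalgebra is a triple $(\mathcal{J},\cdot,\alpha)$ with $\mathcal{J}$ a $\mathbb{Z}_2$-graded vector space, $\cdot:\mathcal{J}\times\mathcal{J}\to\mathcal{J}$ an even bilinear map with $x\cdot y=(-1)^{|x||y|}y\cdot x$, and $\alpha:\mathcal{J}\to\mathcal{J}$ an even linear map, such that for all homogeneous $x,y,z,u$ $$\sum_{x,y,u}(-1)^{|u|(|x|+|z|)}\,as_\alpha(x\cdot y,\alpha(z),\alpha(u))=0,$$ where $\sum_{x,y,u}$ is the cyclic sum over $(x,y,u)$ and $as_\alpha(x,y,z)=(x\cdot y)\cdot\alpha(z)-\alpha(x)\cdot(y\cdot z)$. All Hom-algebras are multiplicative: the twist map is a morphism for the products. A Hom-pre-Jordan superalgebra is a triple $(\mathcal{A},\circ,\alpha)$ with $\mathcal{A}$ a $\mathbb{Z}_2$-graded vector space, $\circ$ an even bilinear product and $\alpha$ an even linear map (with $\alpha(x\circ y)=\alpha(x)\circ\alpha(y)$), such that, with $x\cdot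 y=x\circ y+(-1)^{|x||y|}y\circ x$, for all homogeneous $x,y,z,u$ both $$[\alpha(x)\cdot\alpha(y)]\circ[\alpha(z)\circ\alpha(u)]+(-1)^{|x|(|y|+|z|)}[\alpha(y)\cdot\alpha(z)]\circ[\alpha(x)\circ\alpha(u)]+(-1)^{|z|(|x|+|y|)}[\alpha(z)\cdot\alpha(x)]\circ[\alpha(y)\circ\alpha(u)]$$ and $$\alpha^2(x)\circ[\alpha(y)\circ(z\circ u)]+(-1)^{|z|(|x|+|y|)+|x||y|}\alpha^2(z)\circ[\alpha(y)\circ(x\circ u)]+(-1)^{|y||z|}[(x\cdot z)\cdot\alpha(y)]\circ\alpha^2(u)$$ are equal to $$\alpha^2(x)\circ[(y\cdot z)\circ\alpha(u)]+(-1)^{|x|(|y|+|z|)}\alpha^2(y)\circ[(z\cdot x)\circ\alpha(u)]+(-1)^{|z|(|x|+|y|)}\alpha^2(z)\circ[(x\cdot y)\circ\alpha(u)].$$ *)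

theory Defs
  imports Complex_Main "HOL-Library.Z2" "HOL-Computational_Algebra.Polynomial"
begin

text \<open>
  Parities are elements of the field \<^typ>\<open>bit\<close> of integers mod 2, so that sums and products
  of parities in exponents are computed mod 2; \<open>sign p\<close> is $(-1)^p$.
\<close>

definition sign :: "bit \<Rightarrow> 'k::ring_1" where
  "sign p = (if p = 0 then 1 else - 1)"

text \<open>
  The underlying space is a whole type, and \<open>V i\<close> is its subspace of elements that are
  homogeneous of parity \<open>i\<close>. The zero vector lies in both parts.
\<close>

locale super_vector_space = vector_space scale
  for scale :: "'k::{alg_closed_field, field_char_0} \<Rightarrow> 'v::ab_group_add \<Rightarrow> 'v" (infixr \<open>*s\<close> 75) +
  fixes V :: "bit \<Rightarrow> 'v set"
  assumes subspace_V: "subspace (V i)"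
    and V_independent: "V 0 \<inter> V 1 = {0}"
    and V_span: "\<exists>a\<in>V 0. \<exists>b\<in>V 1. x = a + b"
begin

definition component :: "bit \<Rightarrow> 'v \<Rightarrow> 'v" where
  "component i x = (THE a. a \<in> V i \<and> x - a \<in> V (i + 1))"

text \<open>
  The bilinear extension to all vectors of
  $x \cdot y = x \circ y + (-1)^{|x||y|}\, y \circ x$ for homogeneous $x$, $y$; see
  \<open>super_dot_homogeneous\<close> and \<open>super_dot_unique\<close>.
\<close>

definition super_dot :: "('v \<Rightarrow> 'v \<Rightarrow> 'v) \<Rightarrow> 'v \<Rightarrow> 'v \<Rightarrow> 'v" where
  "super_dot m x y =
     m x y + (\<Sum>i\<in>{0, 1}. \<Sum>j\<in>{0, 1}. sign (i * j) *s m (component j y) (component i x))"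

lemma component_unique:
  assumes "a \<in> V i" and "x - a \<in> V (i + 1)"
  shows "component i x = a"
  unfolding component_def
proof (rule the_equality)
  show "a \<in> V i \<and> x - a \<in> V (i + 1)" using assms by simp
next
  fix b assume b: "b \<in> V i \<and> x - b \<in> V (i + 1)"
  have "b - a \<in> V i" using b assms subspace_diff[OF subspace_V] by blast
  moreover have "(x - a) - (x - b) \<in> V (i + 1)"
    using b assms subspace_diff[OF subspace_V] by blast
  ultimately have "b - a \<in> V 0 \<inter> V 1" by (cases i) auto
  then show "b = a" using V_independent by auto
qed

lemma component_homogeneous:
  assumes "x \<in> V j"
  shows "component i x = (if i = j then x else 0)"
proof (rule component_unique)
  show "(if i = j then x else 0) \<in> V i" using assms subspace_0[OF subspace_V] by simp
  show "x - (if i = j then x else 0) \<in> V (i + 1)"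
    using assms subspace_0[OF subspace_V] by (cases i; cases j) auto
qed

end

locale hom_superalgebra = super_vector_space scale V
  for scale :: "'k::{alg_closed_field, field_char_0} \<Rightarrow> 'v::ab_group_add \<Rightarrow> 'v" (infixr \<open>*s\<close> 75)
    and V :: "bit \<Rightarrow> 'v set" +
  fixes mult :: "'v \<Rightarrow> 'v \<Rightarrow> 'v"
    and \<alpha> :: "'v \<Rightarrow> 'v"
  assumes mult_linear_right: "Vector_Spaces.linear scale scale (\<lambda>y. mult x y)"
    and mult_linear_left: "Vector_Spaces.linear scale scale (\<lambda>x. mult x y)"
    and mult_even: "x \<in> V i \<Longrightarrow> y \<in> V j \<Longrightarrow> mult x y \<in> V (i + j)"
    and twist_linear: "Vector_Spaces.linear scale scale \<alpha>"
    and twist_even: "x \<in> V i \<Longrightarrow> \<alpha> x \<in> V i"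
    and multiplicative: "\<alpha> (mult x y) = mult (\<alpha> x) (\<alpha> y)"
begin

abbreviation dot :: "'v \<Rightarrow> 'v \<Rightarrow> 'v" (infixl \<open>\<odot>\<close> 70) where
  "x \<odot> y \<equiv> super_dot mult x y"

definition hom_associator :: "'v \<Rightarrow> 'v \<Rightarrow> 'v \<Rightarrow> 'v" where
  "hom_associator x y z = mult (mult x y) (\<alpha> z) - mult (\<alpha> x) (mult y z)"

lemma super_dot_homogeneous:
  assumes "x \<in> V i" and "y \<in> V j"
  shows "super_dot mult x y = mult x y + sign (i * j) *s mult y x"
proof -
  have l: "mult 0 z = 0" and r: "mult z 0 = 0" for z
    using module_hom.zero[OF mult_linear_left[of z, unfolded linear_iff_module_hom]]
      module_hom.zero[OF mult_linear_right[of z, unfolded linear_iff_module_hom]]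
    by simp_all
  show ?thesis
    unfolding super_dot_def
    by (cases i; cases j) (simp_all add: component_homogeneous[OF assms(1)]
        component_homogeneous[OF assms(2)] l r)
qed

lemma super_dot_unique:
  assumes "\<And>x. Vector_Spaces.linear scale scale (\<lambda>y. d x y)"
    and "\<And>y. Vector_Spaces.linear scale scale (\<lambda>x. d x y)"
    and "\<And>x y i j. x \<in> V i \<Longrightarrow> y \<in> V j \<Longrightarrow> d x y = mult x y + sign (i * j) *s mult y x"
  shows "d = super_dot mult"
proof (intro ext)
  fix x y
  obtain a b where x: "a \<in> V 0" "b \<in> V 1" "x = a + b" using V_span by blast
  obtain c e where y: "c \<in> V 0" "e \<in> V 1" "y = c + e" using V_span by blast
  have dl: "d (u + v) w = d u w + d v w" and dr: "d w (u + v) = d w u + d w v" for u v w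
    using module_hom.add[OF assms(2)[of w, unfolded linear_iff_module_hom]]
      module_hom.add[OF assms(1)[of w, unfolded linear_iff_module_hom]]
    by simp_all
  have ml: "mult (u + v) w = mult u w + mult v w" and mr: "mult w (u + v) = mult w u + mult w v"
    for u v w
    using module_hom.add[OF mult_linear_left[of w, unfolded linear_iff_module_hom]]
      module_hom.add[OF mult_linear_right[of w, unfolded linear_iff_module_hom]]
    by simp_all
  have cx: "component 0 x = a" "component 1 x = b"
    using x by (auto intro!: component_unique)
  have cy: "component 0 y = c" "component 1 y = e"
    using y by (auto intro!: component_unique)
  show "d x y = super_dot mult x y"
    unfolding super_dot_def
    by (simp add: cx cy) (simp add: x y dl dr ml mr assms(3)[OF x(1) y(1)]
        assms(3)[OF x(1) y(2)] assms(3)[OF x(2) y(1)] assms(3)[OF x(2) y(2)] sign_def)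
qed

end

locale hom_jordan_superalgebra = hom_superalgebra scale V mult \<alpha>
  for scale :: "'k::{alg_closed_field, field_char_0} \<Rightarrow> 'v::ab_group_add \<Rightarrow> 'v" (infixr \<open>*s\<close> 75)
    and V :: "bit \<Rightarrow> 'v set"
    and mult :: "'v \<Rightarrow> 'v \<Rightarrow> 'v" (infixl \<open>\<cdot>\<close> 70)
    and \<alpha> :: "'v \<Rightarrow> 'v" +
  assumes supercommutative: "x \<in> V i \<Longrightarrow> y \<in> V j \<Longrightarrow> x \<cdot> y = sign (i * j) *s (y \<cdot> x)"
    and hom_jordan_identity:
      "x \<in> V i \<Longrightarrow> y \<in> V j \<Longrightarrow> z \<in> V k \<Longrightarrow> u \<in> V l \<Longrightarrow>
         sign (l * (i + k)) *s hom_associator (x \<cdot> y) (\<alpha> z) (\<alpha> u)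
       + sign (i * (j + k)) *s hom_associator (y \<cdot> u) (\<alpha> z) (\<alpha> x)
       + sign (j * (l + k)) *s hom_associator (u \<cdot> x) (\<alpha> z) (\<alpha> y) = 0"

locale hom_pre_jordan_superalgebra = hom_superalgebra scale V mult \<alpha>
  for scale :: "'k::{alg_closed_field, field_char_0} \<Rightarrow> 'v::ab_group_add \<Rightarrow> 'v" (infixr \<open>*s\<close> 75)
    and V :: "bit \<Rightarrow> 'v set"
    and mult :: "'v \<Rightarrow> 'v \<Rightarrow> 'v" (infixl \<open>\<star>\<close> 70)
    and \<alpha> :: "'v \<Rightarrow> 'v" +
  assumes hom_pre_jordan_identity1:
      "x \<in> V i \<Longrightarrow> y \<in> V j \<Longrightarrow> z \<in> V k \<Longrightarrow> u \<in> V l \<Longrightarrow>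
         (\<alpha> x \<odot> \<alpha> y) \<star> (\<alpha> z \<star> \<alpha> u)
       + sign (i * (j + k)) *s ((\<alpha> y \<odot> \<alpha> z) \<star> (\<alpha> x \<star> \<alpha> u))
       + sign (k * (i + j)) *s ((\<alpha> z \<odot> \<alpha> x) \<star> (\<alpha> y \<star> \<alpha> u))
       = \<alpha> (\<alpha> x) \<star> ((y \<odot> z) \<star> \<alpha> u)
       + sign (i * (j + k)) *s (\<alpha> (\<alpha> y) \<star> ((z \<odot> x) \<star> \<alpha> u))
       + sign (k * (i + j)) *s (\<alpha> (\<alpha> z) \<star> ((x \<odot> y) \<star> \<alpha> u))"
    and hom_pre_jordan_identity2:
      "x \<in> V i \<Longrightarrow> y \<in> V j \<Longrightarrow> z \<in> V k \<Longrightarrow> u \<in> V l \<Longrightarrow>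
         \<alpha> (\<alpha> x) \<star> (\<alpha> y \<star> (z \<star> u))
       + sign (k * (i + j) + i * j) *s (\<alpha> (\<alpha> z) \<star> (\<alpha> y \<star> (x \<star> u)))
       + sign (j * k) *s (((x \<odot> z) \<odot> \<alpha> y) \<star> \<alpha> (\<alpha> u))
       = \<alpha> (\<alpha> x) \<star> ((y \<odot> z) \<star> \<alpha> u)
       + sign (i * (j + k)) *s (\<alpha> (\<alpha> y) \<star> ((z \<odot> x) \<star> \<alpha> u))
       + sign (k * (i + j)) *s (\<alpha> (\<alpha> z) \<star> ((x \<odot> y) \<star> \<alpha> u))"

end

theory Submission
  imports Defs
begin

text \<open>
  The two pre-Jordan identities say that left multiplication by \<open>\<star>\<close> represents the product \<open>\<odot>\<close>
  in the way that a Jordan algebra acts on a bimodule, and the Jordan identity for \<open>\<odot>\<close> is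
  recovered by sorting monomials according to their rightmost letter.

  Expanding \<open>(a \<odot> b) = a \<star> b \<plusminus> b \<star> a\<close> everywhere except in the left-hand factors of \<open>\<star>\<close> turns
  each Hom-associator into eight monomials, so the cyclic sum over \<open>x, y, u\<close> has 24 of them
  (lemma \<open>super_dot_associator_expand\<close>). In each, the rightmost letter is the one that is
  acted on, while the others act on it from the left.

  \<^item> The monomials ending in \<open>u\<close> cancel by the identity \<open>jordan_action\<close>. It arises by equating the
    left-hand sides of the two axioms, whose right-hand sides agree. The same holds for those ending
    in \<open>x\<close> and in \<open>y\<close>, as the sum is cyclic.
  \<^item> The monomials ending in \<open>z\<close> are exactly the two sides of the first axiom at \<open>(x, y, u; z)\<close>.

  All signs come from the Koszul rule, so the cancellation takes place for every choice of
  parities. The remaining conditions, that \<open>\<odot>\<close> is bilinear, even, supercommutative and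
  preserved by the twist, hold in any Hom-superalgebra.
\<close>

section \<open>Homogeneous components\<close>

context super_vector_space
begin

lemma component_add_decomposition:
  assumes "a \<in> V 0" and "b \<in> V 1"
  shows "component 0 (a + b) = a" and "component 1 (a + b) = b"
  using assms by (auto intro!: component_unique)

lemma homogeneous_decomposition:
  obtains a b where "a \<in> V 0" and "b \<in> V 1" and "x = a + b"
  using V_span by blast

lemma component_in_V: "component i x \<in> V i"
  by (cases i; rule homogeneous_decomposition[of x]) (simp_all add: component_add_decomposition)

lemma diff_component_in_V: "x - component i x \<in> V (i + 1)"
  by (cases i; rule homogeneous_decomposition[of x]) (simp_all add: component_add_decomposition)

lemma component_add: "component i (x + y) = component i x + component i y"
proof (rule component_unique)
  show "component i x + component i y \<in> V i"
    by (intro subspace_add[OF subspace_V] component_in_V)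
  have "(x - component i x) + (y - component i y) \<in> V (i + 1)"
    by (intro subspace_add[OF subspace_V] diff_component_in_V)
  then show "x + y - (component i x + component i y) \<in> V (i + 1)"
    by (simp add: algebra_simps)
qed

lemma component_scale: "component i (c *s x) = c *s component i x"
proof (rule component_unique)
  show "c *s component i x \<in> V i"
    by (intro subspace_scale[OF subspace_V] component_in_V)
  have "c *s (x - component i x) \<in> V (i + 1)"
    by (intro subspace_scale[OF subspace_V] diff_component_in_V)
  then show "c *s x - c *s component i x \<in> V (i + 1)"
    by (simp add: algebra_simps)
qed

end

section \<open>The super-symmetrized product of a Hom-superalgebra\<close>

context hom_superalgebra
begin

lemma mult_add_left: "mult (x + y) z = mult x z + mult y z"
  and mult_scale_left: "mult (c *s x) z = c *s mult x z"
  using Vector_Spaces.linear_iff[THEN iffD1, OF mult_linear_left[of z]] by auto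

lemma mult_add_right: "mult z (x + y) = mult z x + mult z y"
  and mult_scale_right: "mult z (c *s x) = c *s mult z x"
  using Vector_Spaces.linear_iff[THEN iffD1, OF mult_linear_right[of z]] by auto

lemma twist_add: "\<alpha> (x + y) = \<alpha> x + \<alpha> y"
  and twist_scale: "\<alpha> (c *s x) = c *s \<alpha> x"
  using Vector_Spaces.linear_iff[THEN iffD1, OF twist_linear] by auto

lemma mult_diff_right: "mult z (x - y) = mult z x - mult z y"
  by (metis add_diff_cancel_right' diff_add_cancel mult_add_right)

lemma mult_minus_left: "mult (- x) z = - mult x z"
  by (metis mult_scale_left scale_minus_left scale_one)

lemmas mult_bilinear =
  mult_add_left mult_scale_left mult_add_right mult_scale_right mult_diff_right mult_minus_left

lemma component_twist: "component i (\<alpha> x) = \<alpha> (component i x)"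
proof (rule component_unique)
  show "\<alpha> (component i x) \<in> V i"
    by (intro twist_even component_in_V)
  have "\<alpha> (x - component i x) \<in> V (i + 1)"
    by (intro twist_even diff_component_in_V)
  moreover have "\<alpha> x = \<alpha> (x - component i x) + \<alpha> (component i x)"
    by (simp flip: twist_add)
  ultimately show "\<alpha> x - \<alpha> (component i x) \<in> V (i + 1)"
    by simp
qed

lemma super_dot_even:
  assumes "x \<in> V i" and "y \<in> V j"
  shows "x \<odot> y \<in> V (i + j)"
proof -
  have "mult y x \<in> V (i + j)"
    using mult_even[OF assms(2,1)] by (simp only: add.commute)
  with mult_even[OF assms] show ?thesis
    unfolding super_dot_homogeneous[OF assms]
    by (intro subspace_add[OF subspace_V] subspace_scale[OF subspace_V])
qed

lemma super_dot_supercommutative: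
  assumes "x \<in> V i" and "y \<in> V j"
  shows "x \<odot> y = sign (i * j) *s (y \<odot> x)"
  unfolding super_dot_homogeneous[OF assms] super_dot_homogeneous[OF assms(2,1)]
  by (cases i; cases j) (simp_all add: sign_def)

lemma twist_super_dot: "\<alpha> (x \<odot> y) = \<alpha> x \<odot> \<alpha> y"
  unfolding super_dot_def
  by (simp add: twist_add twist_scale multiplicative component_twist)

lemma super_dot_hom_superalgebra: "hom_superalgebra scale V (super_dot mult) \<alpha>"
proof (intro hom_superalgebra.intro super_vector_space_axioms hom_superalgebra_axioms.intro)
  show "Vector_Spaces.linear scale scale (\<lambda>y. x \<odot> y)" for x
    unfolding super_dot_def Vector_Spaces.linear_iff
    by (simp add: component_add component_scale mult_bilinear vector_space_axioms algebra_simps)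
  show "Vector_Spaces.linear scale scale (\<lambda>x. x \<odot> y)" for y
    unfolding super_dot_def Vector_Spaces.linear_iff
    by (simp add: component_add component_scale mult_bilinear vector_space_axioms algebra_simps)
qed (fact super_dot_even twist_linear twist_even twist_super_dot)+

text \<open>
  The outermost \<open>\<odot>\<close> and those in the right-hand factors that it produces are expanded. In
  left-hand factors \<open>\<odot>\<close> stays intact, since the axioms of a Hom-pre-Jordan superalgebra
  contain it exactly there.
\<close>

lemma super_dot_associator_expand:
  assumes x: "x \<in> V i" and y: "y \<in> V j" and z: "z \<in> V k" and u: "u \<in> V l"
  shows "hom_superalgebra.hom_associator (super_dot mult) \<alpha> (x \<odot> y) (\<alpha> z) (\<alpha> u) =
      mult ((x \<odot> y) \<odot> \<alpha> z) (\<alpha> (\<alpha> u))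
    + sign (l * (i + j + k)) *s mult (\<alpha> (\<alpha> u)) (mult (x \<odot> y) (\<alpha> z))
    + sign (l * (i + j + k) + k * (i + j)) *s mult (\<alpha> (\<alpha> u)) (mult (\<alpha> z) (mult x y))
    + sign (l * (i + j + k) + k * (i + j) + i * j) *s mult (\<alpha> (\<alpha> u)) (mult (\<alpha> z) (mult y x))
    - mult (\<alpha> x \<odot> \<alpha> y) (mult (\<alpha> z) (\<alpha> u))
    - sign (k * l) *s mult (\<alpha> x \<odot> \<alpha> y) (mult (\<alpha> u) (\<alpha> z))
    - sign ((i + j) * (k + l)) *s mult (\<alpha> z \<odot> \<alpha> u) (mult (\<alpha> x) (\<alpha> y))
    - sign ((i + j) * (k + l) + i * j) *s mult (\<alpha> z \<odot> \<alpha> u) (mult (\<alpha> y) (\<alpha> x))"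
proof -
  interpret D: hom_superalgebra scale V "super_dot mult" \<alpha>
    by (rule super_dot_hom_superalgebra)
  note a = twist_even
  note xy = super_dot_even[OF x y]
  note zu = super_dot_even[OF a[OF z] a[OF u]]
  have 1: "((x \<odot> y) \<odot> \<alpha> z) \<odot> \<alpha> (\<alpha> u) = mult ((x \<odot> y) \<odot> \<alpha> z) (\<alpha> (\<alpha> u))
      + sign ((i + j + k) * l) *s mult (\<alpha> (\<alpha> u)) (mult (x \<odot> y) (\<alpha> z)
        + sign ((i + j) * k) *s mult (\<alpha> z) (mult x y + sign (i * j) *s mult y x))"
    using super_dot_homogeneous[OF super_dot_even[OF xy a[OF z]] a[OF a[OF u]]]
      super_dot_homogeneous[OF xy a[OF z]] super_dot_homogeneous[OF x y]
    by simp
  have 2: "(\<alpha> x \<odot> \<alpha> y) \<odot> (\<alpha> z \<odot> \<alpha> u) =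
      mult (\<alpha> x \<odot> \<alpha> y) (mult (\<alpha> z) (\<alpha> u) + sign (k * l) *s mult (\<alpha> u) (\<alpha> z))
      + sign ((i + j) * (k + l)) *s
          mult (\<alpha> z \<odot> \<alpha> u) (mult (\<alpha> x) (\<alpha> y) + sign (i * j) *s mult (\<alpha> y) (\<alpha> x))"
    using super_dot_homogeneous[OF super_dot_even[OF a[OF x] a[OF y]] zu]
      super_dot_homogeneous[OF a[OF x] a[OF y]] super_dot_homogeneous[OF a[OF z] a[OF u]]
    by simp
  show ?thesis
    unfolding D.hom_associator_def twist_super_dot 1 2
    by (cases i; cases j; cases k; cases l) (simp_all add: sign_def mult_bilinear algebra_simps)
qed

end

section \<open>The Jordan identity\<close>

context hom_pre_jordan_superalgebra
begin

text \<open>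
  The two axioms have the same right-hand side, so their left-hand sides are equal. Taken at
  \<open>(x, z, y; u)\<close>, this becomes the cancellation of the monomials ending in \<open>u\<close>, once the symmetric
  products are reordered so that the factors match those of \<open>super_dot_associator_expand\<close>.
\<close>

lemma jordan_action:
  assumes x: "x \<in> V i" and y: "y \<in> V j" and z: "z \<in> V k" and u: "u \<in> V l"
  shows "((x \<odot> y) \<odot> \<alpha> z) \<star> \<alpha> (\<alpha> u)
       + sign (j * k) *s (\<alpha> (\<alpha> x) \<star> (\<alpha> z \<star> (y \<star> u)))
       + sign (i * (j + k)) *s (\<alpha> (\<alpha> y) \<star> (\<alpha> z \<star> (x \<star> u)))
       = (\<alpha> x \<odot> \<alpha> y) \<star> (\<alpha> z \<star> \<alpha> u)
       + sign (k * (i + j)) *s ((\<alpha> z \<odot> \<alpha> x) \<star> (\<alpha> y \<star> \<alpha> u))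
       + sign (i * (j + k) + j * k) *s ((\<alpha> z \<odot> \<alpha> y) \<star> (\<alpha> x \<star> \<alpha> u))"
    (is "?L = ?R")
proof -
  note a = twist_even
  have *: "\<alpha> (\<alpha> x) \<star> (\<alpha> z \<star> (y \<star> u))
       + sign (j * (i + k) + i * k) *s (\<alpha> (\<alpha> y) \<star> (\<alpha> z \<star> (x \<star> u)))
       + sign (k * j) *s (((x \<odot> y) \<odot> \<alpha> z) \<star> \<alpha> (\<alpha> u))
       = (\<alpha> x \<odot> \<alpha> z) \<star> (\<alpha> y \<star> \<alpha> u)
       + sign (i * (k + j)) *s ((\<alpha> z \<odot> \<alpha> y) \<star> (\<alpha> x \<star> \<alpha> u))
       + sign (j * (i + k)) *s ((\<alpha> y \<odot> \<alpha> x) \<star> (\<alpha> z \<star> \<alpha> u))" (is "?L' = ?R'")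
    using hom_pre_jordan_identity1[OF x z y u] hom_pre_jordan_identity2[OF x z y u] by simp
  have "?L = sign (j * k) *s ?L'"
    by (cases i; cases j; cases k) (simp_all add: sign_def algebra_simps)
  also have "\<dots> = sign (j * k) *s ?R'"
    by (simp only: *)
  also have "\<dots> = ?R"
    unfolding super_dot_supercommutative[OF a[OF x] a[OF z]]
      super_dot_supercommutative[OF a[OF y] a[OF x]]
    by (cases i; cases j; cases k) (simp_all add: sign_def mult_bilinear algebra_simps)
  finally show ?thesis .
qed

lemma super_dot_hom_jordan_identity:
  assumes x: "x \<in> V i" and y: "y \<in> V j" and z: "z \<in> V k" and u: "u \<in> V l"
  defines "as \<equiv> hom_superalgebra.hom_associator (super_dot mult) \<alpha>"
  shows "sign (l * (i + k)) *s as (x \<odot> y) (\<alpha> z) (\<alpha> u)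
       + sign (i * (j + k)) *s as (y \<odot> u) (\<alpha> z) (\<alpha> x)
       + sign (j * (l + k)) *s as (u \<odot> x) (\<alpha> z) (\<alpha> y) = 0"
proof -
  \<comment> \<open>The cyclic sum is a signed sum of four relations, one for each rightmost letter. The relations
      for \<open>u\<close>, \<open>x\<close> and \<open>y\<close> carry the signs of the cyclic sum, since \<open>jordan_action\<close> has leading
      sign 1. The sign of the one for \<open>z\<close> is found by comparing coefficients at
      \<open>\<alpha> (\<alpha> u) \<star> ((x \<odot> y) \<star> \<alpha> z)\<close>: the product of the signs with exponents \<open>l * (i + k)\<close>,
      \<open>l * (i + j + k)\<close> and \<open>l * (i + j)\<close> has exponent \<open>i * l\<close>.\<close>
  define lhs where "lhs x i y j z k u =
         ((x \<odot> y) \<odot> \<alpha> z) \<star> \<alpha> (\<alpha> u)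
       + sign (j * k) *s (\<alpha> (\<alpha> x) \<star> (\<alpha> z \<star> (y \<star> u)))
       + sign (i * (j + k)) *s (\<alpha> (\<alpha> y) \<star> (\<alpha> z \<star> (x \<star> u)))" for x y z u i j k
  define rhs where "rhs x i y j z k u =
         (\<alpha> x \<odot> \<alpha> y) \<star> (\<alpha> z \<star> \<alpha> u)
       + sign (k * (i + j)) *s ((\<alpha> z \<odot> \<alpha> x) \<star> (\<alpha> y \<star> \<alpha> u))
       + sign (i * (j + k) + j * k) *s ((\<alpha> z \<odot> \<alpha> y) \<star> (\<alpha> x \<star> \<alpha> u))" for x y z u i j k
  have action: "lhs x i y j z k u = rhs x i y j z k u"
    if "x \<in> V i" "y \<in> V j" "z \<in> V k" "u \<in> V l" for x y z u i j k l
    unfolding lhs_def rhs_def by (rule jordan_action[OF that])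
  define lhs_z where "lhs_z =
         \<alpha> (\<alpha> x) \<star> ((y \<odot> u) \<star> \<alpha> z)
       + sign (i * (j + l)) *s (\<alpha> (\<alpha> y) \<star> ((u \<odot> x) \<star> \<alpha> z))
       + sign (l * (i + j)) *s (\<alpha> (\<alpha> u) \<star> ((x \<odot> y) \<star> \<alpha> z))"
  define rhs_z where "rhs_z =
         (\<alpha> x \<odot> \<alpha> y) \<star> (\<alpha> u \<star> \<alpha> z)
       + sign (i * (j + l)) *s ((\<alpha> y \<odot> \<alpha> u) \<star> (\<alpha> x \<star> \<alpha> z))
       + sign (l * (i + j)) *s ((\<alpha> u \<odot> \<alpha> x) \<star> (\<alpha> y \<star> \<alpha> z))"
  have action_z: "lhs_z = rhs_z"
    unfolding lhs_z_def rhs_z_def by (rule hom_pre_jordan_identity1[OF x y u z, symmetric])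
  have "sign (l * (i + k)) *s as (x \<odot> y) (\<alpha> z) (\<alpha> u)
       + sign (i * (j + k)) *s as (y \<odot> u) (\<alpha> z) (\<alpha> x)
       + sign (j * (l + k)) *s as (u \<odot> x) (\<alpha> z) (\<alpha> y)
     = sign (l * (i + k)) *s (lhs x i y j z k u - rhs x i y j z k u)
       + sign (i * (j + k)) *s (lhs y j u l z k x - rhs y j u l z k x)
       + sign (j * (l + k)) *s (lhs u l x i z k y - rhs u l x i z k y)
       + sign (i * l) *s (lhs_z - rhs_z)"
    unfolding as_def super_dot_associator_expand[OF x y z u]
      super_dot_associator_expand[OF y u z x] super_dot_associator_expand[OF u x z y]
      lhs_def rhs_def lhs_z_def rhs_z_def
    by (cases i; cases j; cases k; cases l) (simp_all add: sign_def algebra_simps)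
  also have "\<dots> = 0"
    using action[OF x y z u] action[OF y u z x] action[OF u x z y] action_z by simp
  finally show ?thesis .
qed

end

theorem proposition4p5:
  fixes scale :: "'k::{alg_closed_field, field_char_0} \<Rightarrow> 'v::ab_group_add \<Rightarrow> 'v"
    and V :: "bit \<Rightarrow> 'v set"
    and mult :: "'v \<Rightarrow> 'v \<Rightarrow> 'v"
    and \<alpha> :: "'v \<Rightarrow> 'v"
  assumes "hom_pre_jordan_superalgebra scale V mult \<alpha>"
  shows "hom_jordan_superalgebra scale V (super_vector_space.super_dot scale V mult) \<alpha>"
proof -
  interpret hom_pre_jordan_superalgebra scale V mult \<alpha>
    by (rule assms)
  interpret D: hom_superalgebra scale V "super_dot mult" \<alpha>
    by (rule super_dot_hom_superalgebra)
  show ?thesis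
    by unfold_locales (fact super_dot_supercommutative super_dot_hom_jordan_identity)+
qed

end
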